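(* Let $(X,\mathscr{A},\mu)$ be a probability measure space. Then $\mathcal{M}_\mu$ is locally compact if and only if $\mu$ is bounded away from zero.
   Context: $\mathcal{M}$ is the ring of real-valued measurable functions on $(X,\mathscr{A},\mu)$, where two functions that are equal $\mu$-almost everywhere are identified. A sequence $\{f_n\}$ in $\mathcal{M}$ converges in measure to $f\in\mathcal{M}$ if for each $c>0$, $\lim_{n\to\infty}\mu(\{x\in X:|f_n(x)-f(x)|>c\})=0$. For $A\subseteq\mathcal{M}$, $\overline{A}$ is the set of all $f\in\mathcal{M}$ for which there is a sequence in $A$ converging to $f$ in measure. $\mathcal{M}_\mu$ denotes $\mathcal{M}$ with the topology of convergence in measure, i.e. the topology $\{\mathcal{M}\setminus A: A\subseteq\mathcal{M},\ A=\overline{A}\}$. The measure $\mu$ is bounded away from zero if there exists $\lambda>0$ such that for every $A\in\mathscr{A}$ either $\mu(A)=0$ or $\mu(A)\ge\lambda$. *)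

theory Defs
  imports "HOL-Probability.Probability"
begin

definition ae_eq :: "'a measure \<Rightarrow> (('a \<Rightarrow> real) \<times> ('a \<Rightarrow> real)) set" where
  "ae_eq M = {(f, g). f \<in> borel_measurable M \<and> g \<in> borel_measurable M \<and> (AE x in M. f x = g x)}"

text \<open>
  Functions in \<^term>\<open>borel_measurable M\<close> are arbitrary outside \<^term>\<open>space M\<close>; since
  \<^term>\<open>AE x in M. P x\<close> only concerns points of \<^term>\<open>space M\<close>, functions that agree on
  \<^term>\<open>space M\<close> lie in the same class.
\<close>

definition meas_classes :: "'a measure \<Rightarrow> ('a \<Rightarrow> real) set set" where
  "meas_classes M = borel_measurable M // ae_eq M"

lemma equiv_ae_eq: "equiv (borel_measurable M) (ae_eq M)"
proof (rule equivI)
  show "ae_eq M \<subseteq> borel_measurable M \<times> borel_measurable M"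
    by (auto simp: ae_eq_def)
  show "refl_on (borel_measurable M) (ae_eq M)"
    by (auto simp: ae_eq_def refl_on_def)
  show "sym (ae_eq M)"
    by (simp add: ae_eq_def sym_def eq_commute)
  show "trans (ae_eq M)"
  proof (rule transI)
    fix f g h assume "(f, g) \<in> ae_eq M" and "(g, h) \<in> ae_eq M"
    then have ae: "AE x in M. f x = g x" "AE x in M. g x = h x"
      and m: "f \<in> borel_measurable M" "h \<in> borel_measurable M"
      by (auto simp: ae_eq_def)
    from ae have "AE x in M. f x = h x" by eventually_elim simp
    with m show "(f, h) \<in> ae_eq M" by (simp add: ae_eq_def)
  qed
qed

definition conv_in_measure :: "'a measure \<Rightarrow> (nat \<Rightarrow> 'a \<Rightarrow> real) \<Rightarrow> ('a \<Rightarrow> real) \<Rightarrow> bool" where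
  "conv_in_measure M fs f \<longleftrightarrow>
     (\<forall>c>0. (\<lambda>n. emeasure M {x \<in> space M. \<bar>fs n x - f x\<bar> > c}) \<longlonglongrightarrow> 0)"

lemma conv_in_measure_cong_AE:
  assumes "\<And>n. (fs n, gs n) \<in> ae_eq M" and "(f, g) \<in> ae_eq M"
  shows "conv_in_measure M fs f \<longleftrightarrow> conv_in_measure M gs g"
proof -
  have "emeasure M {x \<in> space M. \<bar>fs n x - f x\<bar> > c}
      = emeasure M {x \<in> space M. \<bar>gs n x - g x\<bar> > c}" for n c
  proof (rule emeasure_eq_AE)
    have [measurable]: "fs n \<in> borel_measurable M" "gs n \<in> borel_measurable M"
      "f \<in> borel_measurable M" "g \<in> borel_measurable M"
      using assms(1)[of n] assms(2) by (auto simp: ae_eq_def)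
    have "AE x in M. fs n x = gs n x" "AE x in M. f x = g x"
      using assms(1)[of n] assms(2) by (auto simp: ae_eq_def)
    then show "AE x in M. x \<in> {x \<in> space M. \<bar>fs n x - f x\<bar> > c}
        \<longleftrightarrow> x \<in> {x \<in> space M. \<bar>gs n x - g x\<bar> > c}"
      by eventually_elim auto
    show "{x \<in> space M. \<bar>fs n x - f x\<bar> > c} \<in> sets M"
      "{x \<in> space M. \<bar>gs n x - g x\<bar> > c} \<in> sets M"
      by measurable
  qed
  then show ?thesis by (simp add: conv_in_measure_def)
qed

text \<open>
  Convergence of classes is convergence of representatives; by
  \<open>conv_in_measure_cong_AE\<close> the choice of the representatives is immaterial.
\<close>

definition class_conv_in_measure ::
  "'a measure \<Rightarrow> (nat \<Rightarrow> ('a \<Rightarrow> real) set) \<Rightarrow> ('a \<Rightarrow> real) set \<Rightarrow> bool" where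
  "class_conv_in_measure M Fs F \<longleftrightarrow>
     (\<exists>fs f. (\<forall>n. fs n \<in> Fs n) \<and> f \<in> F \<and> conv_in_measure M fs f)"

lemma class_conv_in_measure_iff:
  assumes "\<And>n. Fs n \<in> meas_classes M" and "F \<in> meas_classes M"
    and "\<And>n. fs n \<in> Fs n" and "f \<in> F"
  shows "class_conv_in_measure M Fs F \<longleftrightarrow> conv_in_measure M fs f"
proof
  assume "class_conv_in_measure M Fs F"
  then obtain gs g where g: "\<And>n. gs n \<in> Fs n" "g \<in> F" "conv_in_measure M gs g"
    by (auto simp: class_conv_in_measure_def)
  have "(gs n, fs n) \<in> ae_eq M" for n
    using in_quotient_imp_in_rel[OF equiv_ae_eq, of "Fs n" M "gs n" "fs n"] assms g
    by (simp add: meas_classes_def)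
  moreover have "(g, f) \<in> ae_eq M"
    using in_quotient_imp_in_rel[OF equiv_ae_eq, of F M g f] assms g
    by (simp add: meas_classes_def)
  ultimately show "conv_in_measure M fs f"
    using g(3) conv_in_measure_cong_AE by blast
next
  assume "conv_in_measure M fs f"
  then show "class_conv_in_measure M Fs F"
    using assms by (auto simp: class_conv_in_measure_def)
qed

definition measure_closure :: "'a measure \<Rightarrow> ('a \<Rightarrow> real) set set \<Rightarrow> ('a \<Rightarrow> real) set set" where
  "measure_closure M A =
     {F \<in> meas_classes M. \<exists>Fs. (\<forall>n. Fs n \<in> A) \<and> class_conv_in_measure M Fs F}"

definition measure_topology :: "'a measure \<Rightarrow> ('a \<Rightarrow> real) set topology" where
  "measure_topology M =
     topology (\<lambda>U. \<exists>A \<subseteq> meas_classes M. A = measure_closure M A \<and> U = meas_classes M - A)"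

lemma class_conv_in_measure_subseq:
  assumes "class_conv_in_measure M Fs F" and "strict_mono r"
  shows "class_conv_in_measure M (Fs \<circ> r) F"
proof -
  obtain fs f where f: "\<And>n. fs n \<in> Fs n" "f \<in> F" "conv_in_measure M fs f"
    using assms(1) by (auto simp: class_conv_in_measure_def)
  have "conv_in_measure M (fs \<circ> r) f"
    unfolding conv_in_measure_def
  proof (intro allI impI)
    fix c :: real assume "c > 0"
    then have "(\<lambda>n. emeasure M {x \<in> space M. \<bar>fs n x - f x\<bar> > c}) \<longlonglongrightarrow> 0"
      using f(3) by (auto simp: conv_in_measure_def)
    from LIMSEQ_subseq_LIMSEQ[OF this assms(2)]
    show "(\<lambda>n. emeasure M {x \<in> space M. \<bar>(fs \<circ> r) n x - f x\<bar> > c}) \<longlonglongrightarrow> 0"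
      by (simp add: o_def)
  qed
  with f show ?thesis
    unfolding class_conv_in_measure_def by (intro exI[of _ "fs \<circ> r"] exI[of _ f]) auto
qed

lemma measure_closure_subset: "measure_closure M A \<subseteq> meas_classes M"
  by (auto simp: measure_closure_def)

lemma measure_closure_mono: "A \<subseteq> B \<Longrightarrow> measure_closure M A \<subseteq> measure_closure M B"
  unfolding measure_closure_def by blast

lemma subset_measure_closure:
  assumes "A \<subseteq> meas_classes M"
  shows "A \<subseteq> measure_closure M A"
proof
  fix F assume F: "F \<in> A"
  then have "F \<in> meas_classes M" using assms by auto
  moreover from this have "F \<noteq> {}"
    unfolding meas_classes_def by (rule in_quotient_imp_non_empty[OF equiv_ae_eq])
  then obtain f where "f \<in> F" by auto
  then have "class_conv_in_measure M (\<lambda>n. F) F"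
    unfolding class_conv_in_measure_def
    by (intro exI[of _ "\<lambda>n. f"] exI[of _ f]) (auto simp: conv_in_measure_def)
  ultimately show "F \<in> measure_closure M A"
    using F unfolding measure_closure_def by (auto intro!: exI[of _ "\<lambda>n. F"])
qed

lemma measure_closure_Un: "measure_closure M (A \<union> B) = measure_closure M A \<union> measure_closure M B"
proof (intro equalityI Un_least measure_closure_mono subsetI)
  fix F assume "F \<in> measure_closure M (A \<union> B)"
  then obtain Fs where F: "F \<in> meas_classes M" "\<And>n. Fs n \<in> A \<union> B" "class_conv_in_measure M Fs F"
    by (auto simp: measure_closure_def)
  have sub: "F \<in> measure_closure M C" if inf: "infinite {n. Fs n \<in> C}" for C
  proof -
    obtain r :: "nat \<Rightarrow> nat" where r: "strict_mono r" "\<And>n. r n \<in> {n. Fs n \<in> C}"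
      using infinite_enumerate[OF inf] by blast
    then have "\<forall>n. (Fs \<circ> r) n \<in> C" by simp
    with F(1) class_conv_in_measure_subseq[OF F(3) r(1)] show ?thesis
      unfolding measure_closure_def by blast
  qed
  have "{n. Fs n \<in> A} \<union> {n. Fs n \<in> B} = UNIV" using F(2) by auto
  then have "infinite {n. Fs n \<in> A} \<or> infinite {n. Fs n \<in> B}"
    by (metis finite_Un infinite_UNIV_nat)
  then show "F \<in> measure_closure M A \<union> measure_closure M B"
    using sub by auto
qed auto

lemma istopology_measure_topology:
  "istopology (\<lambda>U. \<exists>A \<subseteq> meas_classes M. A = measure_closure M A \<and> U = meas_classes M - A)"
  unfolding istopology_def
proof (intro conjI allI impI)
  fix S T
  assume "\<exists>A \<subseteq> meas_classes M. A = measure_closure M A \<and> S = meas_classes M - A"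
    and "\<exists>A \<subseteq> meas_classes M. A = measure_closure M A \<and> T = meas_classes M - A"
  then obtain A B where
    "A \<subseteq> meas_classes M" "A = measure_closure M A" "S = meas_classes M - A"
    "B \<subseteq> meas_classes M" "B = measure_closure M B" "T = meas_classes M - B"
    by blast
  then have "A \<union> B \<subseteq> meas_classes M \<and> A \<union> B = measure_closure M (A \<union> B)
      \<and> S \<inter> T = meas_classes M - (A \<union> B)"
    using measure_closure_Un[of M A B] by (metis Diff_Un Un_least)
  then show "\<exists>A \<subseteq> meas_classes M. A = measure_closure M A \<and> S \<inter> T = meas_classes M - A"
    by blast
next
  fix \<K>
  assume K: "\<forall>K\<in>\<K>. \<exists>A \<subseteq> meas_classes M. A = measure_closure M A \<and> K = meas_classes M - A"
  define A where "A = meas_classes M - \<Union>\<K>"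
  have "measure_closure M A \<subseteq> A"
  proof
    fix F assume F: "F \<in> measure_closure M A"
    have "F \<notin> K" if "K \<in> \<K>" for K
    proof -
      obtain B where B: "B = measure_closure M B" "K = meas_classes M - B"
        using bspec[OF K \<open>K \<in> \<K>\<close>] by (elim exE conjE)
      have "A \<subseteq> B" using B(2) \<open>K \<in> \<K>\<close> by (auto simp: A_def)
      then have "F \<in> B" using F B(1) measure_closure_mono[of A B M] by blast
      then show ?thesis using B(2) by blast
    qed
    then show "F \<in> A" using F measure_closure_subset by (auto simp: A_def)
  qed
  moreover have "A \<subseteq> measure_closure M A"
    by (rule subset_measure_closure) (auto simp: A_def)
  moreover have "\<Union>\<K> \<subseteq> meas_classes M" using K by blast
  ultimately show "\<exists>A \<subseteq> meas_classes M. A = measure_closure M A \<and> \<Union>\<K> = meas_classes M - A"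
    by (intro exI[of _ A]) (auto simp: A_def)
qed

lemma openin_measure_topology:
  "openin (measure_topology M) U \<longleftrightarrow>
     (\<exists>A \<subseteq> meas_classes M. A = measure_closure M A \<and> U = meas_classes M - A)"
  unfolding measure_topology_def topology_inverse'[OF istopology_measure_topology] ..

lemma topspace_measure_topology: "topspace (measure_topology M) = meas_classes M"
proof
  show "topspace (measure_topology M) \<subseteq> meas_classes M"
    unfolding topspace_def by (auto simp: openin_measure_topology)
  have "openin (measure_topology M) (meas_classes M)"
    unfolding openin_measure_topology
    by (intro exI[of _ "{}"]) (auto simp: measure_closure_def)
  then show "meas_classes M \<subseteq> topspace (measure_topology M)"
    by (rule openin_subset)
qed

definition bounded_away_from_zero :: "'a measure \<Rightarrow> bool" where
  "bounded_away_from_zero M \<longleftrightarrow>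
     (\<exists>c::real. c > 0 \<and> (\<forall>A \<in> sets M. emeasure M A = 0 \<or> emeasure M A \<ge> ennreal c))"

end

theory Submission
  imports Defs
begin

text \<open>
  If there are sets \<open>A\<close> of arbitrarily small positive measure, then every neighbourhood of \<open>0\<close>
  contains all multiples \<open>c 1\<^sub>A\<close> of some indicator with \<open>\<mu>(A) > 0\<close>, and these escape the
  increasing open sets of classes not essentially larger than \<open>n\<close> on \<open>A\<close>; so no neighbourhood of
  \<open>0\<close> is relatively compact. If \<open>\<mu>\<close> is bounded away from zero, a maximal finite measurable
  partition into sets of positive measure consists of atoms, on which measurable functions are
  almost everywhere constant. Hence every class is represented by \<open>v \<circ> p\<close> with \<open>p\<close> the index map
  of the partition, and the uniform unit ball around a class lies in the image, under the
  continuous map \<open>v \<mapsto> v \<circ> p\<close>, of a compact product of intervals.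
\<close>

section \<open>Open sets of classes\<close>

definition ae_class :: "'a measure \<Rightarrow> ('a \<Rightarrow> real) \<Rightarrow> ('a \<Rightarrow> real) set" where
  "ae_class M f = ae_eq M `` {f}"

lemma ae_class_in_meas_classes: "f \<in> borel_measurable M \<Longrightarrow> ae_class M f \<in> meas_classes M"
  by (simp add: ae_class_def meas_classes_def quotientI)

lemma ae_class_self: "f \<in> borel_measurable M \<Longrightarrow> f \<in> ae_class M f"
  by (simp add: ae_class_def ae_eq_def)

lemma meas_classes_memberE:
  assumes "F \<in> meas_classes M"
  obtains f where "f \<in> F" "f \<in> borel_measurable M" "F = ae_class M f"
proof -
  from assms obtain f where "f \<in> borel_measurable M" "F = ae_class M f"
    unfolding meas_classes_def ae_class_def by (rule quotientE)
  with that ae_class_self show thesis by blast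
qed

lemma ae_class_eq_iff:
  assumes "f \<in> borel_measurable M" "g \<in> borel_measurable M"
  shows "ae_class M f = ae_class M g \<longleftrightarrow> (AE x in M. f x = g x)"
  using eq_equiv_class_iff[OF equiv_ae_eq assms] assms
  by (simp add: ae_class_def ae_eq_def)

text \<open>The complement contains its sequential limits: every representative of a class outside
  the image violates \<open>P\<close>, so such classes cannot converge to one that has a
  representative satisfying \<open>P\<close>.\<close>

lemma openin_measure_topology_ae_classI:
  assumes "\<And>fs f. \<lbrakk>\<And>n. fs n \<in> borel_measurable M; f \<in> borel_measurable M;
      conv_in_measure M fs f; P f\<rbrakk> \<Longrightarrow> \<exists>n. P (fs n)"
  shows "openin (measure_topology M) (ae_class M ` {f \<in> borel_measurable M. P f})"
proof -
  let ?U = "ae_class M ` {f \<in> borel_measurable M. P f}"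
  let ?A = "meas_classes M - ?U"
  have "measure_closure M ?A \<subseteq> ?A"
  proof
    fix F assume "F \<in> measure_closure M ?A"
    then obtain Fs where F: "F \<in> meas_classes M" "\<And>n. Fs n \<in> ?A"
      "class_conv_in_measure M Fs F"
      by (auto simp: measure_closure_def)
    have "\<exists>f. f \<in> Fs n \<and> f \<in> borel_measurable M \<and> Fs n = ae_class M f" for n
      using F(2)[of n] by (metis DiffD1 meas_classes_memberE)
    then obtain fs where fs: "\<And>n. fs n \<in> Fs n" "\<And>n. fs n \<in> borel_measurable M"
      "\<And>n. Fs n = ae_class M (fs n)" by metis
    have "F \<notin> ?U"
    proof
      assume "F \<in> ?U"
      then obtain f where f: "f \<in> borel_measurable M" "P f" "F = ae_class M f" by auto
      have "conv_in_measure M fs f"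
        using class_conv_in_measure_iff[of Fs M F fs f] F fs f ae_class_self by blast
      then obtain n where "P (fs n)" using assms[of fs f] fs f by blast
      then have "Fs n \<in> ?U" using fs by blast
      then show False using F(2) by blast
    qed
    with F(1) show "F \<in> ?A" by blast
  qed
  moreover have "?A \<subseteq> measure_closure M ?A" by (rule subset_measure_closure) auto
  moreover have "?U \<subseteq> meas_classes M" by (auto intro: ae_class_in_meas_classes)
  ultimately show ?thesis
    unfolding openin_measure_topology by (intro exI[of _ ?A]) auto
qed

text \<open>If no \<open>ae_class M (fs n)\<close> lay in \<open>U\<close>, all of them would lie in
  the closed complement, and hence so would the limit.\<close>

lemma openin_measure_topology_conv:
  assumes "openin (measure_topology M) U" "conv_in_measure M fs f"
    "\<And>n. fs n \<in> borel_measurable M" "f \<in> borel_measurable M" "ae_class M f \<in> U"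
  shows "\<exists>n. ae_class M (fs n) \<in> U"
proof (rule ccontr)
  assume no: "\<nexists>n. ae_class M (fs n) \<in> U"
  obtain A where A: "A = measure_closure M A" "U = meas_classes M - A"
    using assms(1) unfolding openin_measure_topology by metis
  have "class_conv_in_measure M (\<lambda>n. ae_class M (fs n)) (ae_class M f)"
    unfolding class_conv_in_measure_def using assms ae_class_self by blast
  moreover have "ae_class M (fs n) \<in> A" for n
    using no A(2) ae_class_in_meas_classes[OF assms(3)] by blast
  ultimately have "ae_class M f \<in> measure_closure M A"
    unfolding measure_closure_def using ae_class_in_meas_classes[OF assms(4)]
    by (auto intro!: exI[of _ "\<lambda>n. ae_class M (fs n)"])
  then show False using A assms(5) by blast
qed

lemma conv_in_measure_eventually_less:
  assumes "conv_in_measure M fs f" "c > 0" "d > 0"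
  shows "\<exists>n. emeasure M {x \<in> space M. \<bar>fs n x - f x\<bar> > c} < d"
  using assms order_tendstoD(2)[of _ 0 sequentially d]
  unfolding conv_in_measure_def eventually_sequentially by blast

section \<open>Sets of small measure obstruct local compactness\<close>

text \<open>This is the condition that the essential infimum of \<bar>f\<bar> over \<open>A\<close>
  is below \<open>r\<close>. The gap between \<open>c\<close> and \<open>r\<close> is what survives
  a small perturbation of \<open>f\<close>.\<close>

definition not_ess_above :: "'a measure \<Rightarrow> 'a set \<Rightarrow> real \<Rightarrow> ('a \<Rightarrow> real) \<Rightarrow> bool" where
  "not_ess_above M A r f \<longleftrightarrow> (\<exists>c<r. \<not> (AE x in M. x \<in> A \<longrightarrow> \<bar>f x\<bar> > c))"

text \<open>On a subset of \<open>A\<close> of positive measure, \<bar>f\<bar> is at most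
  \<open>c\<close>. An approximant exceeding the midpoint of \<open>c\<close> and \<open>r\<close>
  almost everywhere on \<open>A\<close> would deviate by more than \<open>(r - c) / 2\<close> almost
  everywhere on that subset, which fails once the deviation set has smaller measure.\<close>

lemma openin_not_ess_above:
  assumes [measurable]: "A \<in> sets M"
  shows "openin (measure_topology M) (ae_class M ` {f \<in> borel_measurable M. not_ess_above M A r f})"
proof (rule openin_measure_topology_ae_classI)
  fix fs f
  assume [measurable]: "\<And>n. fs n \<in> borel_measurable M" "f \<in> borel_measurable M"
    and conv: "conv_in_measure M fs f" and "not_ess_above M A r f"
  then obtain c where c: "c < r" "\<not> (AE x in M. x \<in> A \<longrightarrow> \<bar>f x\<bar> > c)"
    by (auto simp: not_ess_above_def)
  define S where "S = {x \<in> space M. \<not> (x \<in> A \<longrightarrow> \<bar>f x\<bar> > c)}"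
  have [measurable]: "S \<in> sets M" unfolding S_def by measurable
  have "emeasure M S > 0"
    using c(2) AE_iff_measurable[of S M "\<lambda>x. x \<in> A \<longrightarrow> \<bar>f x\<bar> > c"]
    by (auto simp: S_def zero_less_iff_neq_zero)
  then obtain n where n: "emeasure M {x \<in> space M. \<bar>fs n x - f x\<bar> > (r - c) / 2} < emeasure M S"
    using conv_in_measure_eventually_less[OF conv, of "(r - c) / 2"] c(1) by auto
  have "\<not> (AE x in M. x \<in> A \<longrightarrow> \<bar>fs n x\<bar> > (r + c) / 2)"
  proof
    assume "AE x in M. x \<in> A \<longrightarrow> \<bar>fs n x\<bar> > (r + c) / 2"
    then have "AE x in M. x \<in> S \<longrightarrow> x \<in> {x \<in> space M. \<bar>fs n x - f x\<bar> > (r - c) / 2}"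
      by eventually_elim (auto simp: S_def field_simps abs_if split: if_splits)
    then have "emeasure M S \<le> emeasure M {x \<in> space M. \<bar>fs n x - f x\<bar> > (r - c) / 2}"
      by (rule emeasure_mono_AE) measurable
    with n show False by simp
  qed
  moreover have "(r + c) / 2 < r" using c(1) by simp
  ultimately show "\<exists>n. not_ess_above M A r (fs n)" unfolding not_ess_above_def by blast
qed

lemma ex_not_ess_above:
  assumes "emeasure M A \<noteq> 0" and [measurable]: "A \<in> sets M"
  shows "\<exists>n::nat. not_ess_above M A (real n) f"
proof (rule ccontr)
  assume "\<nexists>n::nat. not_ess_above M A (real n) f"
  \<comment> \<open>The bound \<open>n\<close> comes from the failure at \<open>r = Suc n\<close>,
    because the definition asks for \<open>c < r\<close>.\<close>
  then have "AE x in M. x \<in> A \<longrightarrow> \<bar>f x\<bar> > real n" for n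
    unfolding not_ess_above_def by (metis of_nat_less_iff lessI)
  then have "AE x in M. \<forall>n. x \<in> A \<longrightarrow> \<bar>f x\<bar> > real n"
    by (subst AE_all_countable) blast
  then have "AE x in M. x \<notin> A"
    by eventually_elim (meson less_asym reals_Archimedean2)
  then show False using assms by (simp add: AE_iff_null_sets[symmetric] null_sets_def)
qed

text \<open>A multiple of \<open>indicator A\<close> differs from 0 only on \<open>A\<close>, so
  indicators of shrinking sets converge to 0 in measure however large their factors are. Bad factors
  \<open>c n\<close> for sets \<open>A n\<close> of measure below \<open>1 / Suc n\<close> would
  therefore contradict openness of \<open>U\<close>.\<close>

lemma multiples_in_neighbourhood:
  assumes "\<not> bounded_away_from_zero M" "openin (measure_topology M) U" "ae_class M (\<lambda>x. 0) \<in> U"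
  obtains A where "A \<in> sets M" "emeasure M A \<noteq> 0"
    "\<And>c. ae_class M (\<lambda>x. c * indicator A x) \<in> U"
proof (rule ccontr)
  note found = that
  assume neg: "\<not> thesis"
  have "\<exists>A. A \<in> sets M \<and> emeasure M A \<noteq> 0 \<and> emeasure M A < ennreal (1 / Suc n)" for n
    using assms(1) unfolding bounded_away_from_zero_def
    by (metis not_less zero_less_divide_1_iff of_nat_0_less_iff zero_less_Suc)
  then obtain A where A: "\<And>n. A n \<in> sets M" "\<And>n. emeasure M (A n) \<noteq> 0"
    "\<And>n. emeasure M (A n) < ennreal (1 / Suc n)" by metis
  have "\<exists>c. ae_class M (\<lambda>x. c * indicator (A n) x) \<notin> U" for n
    using found[of "A n"] A neg by blast
  then obtain c where c: "\<And>n. ae_class M (\<lambda>x. c n * indicator (A n) x) \<notin> U" by metis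
  have lim: "(\<lambda>n. emeasure M (A n)) \<longlonglongrightarrow> 0"
  proof (rule tendsto_sandwich[OF _ _ tendsto_const])
    show "(\<lambda>n. ennreal (1 / Suc n)) \<longlonglongrightarrow> 0"
      using tendsto_ennrealI[OF LIMSEQ_inverse_real_of_nat]
      by (simp add: inverse_eq_divide)
    show "\<forall>\<^sub>F n in sequentially. emeasure M (A n) \<le> ennreal (1 / Suc n)"
      using A(3) by (auto intro: always_eventually less_imp_le)
  qed auto
  have "conv_in_measure M (\<lambda>n x. c n * indicator (A n) x) (\<lambda>x. 0)"
    unfolding conv_in_measure_def
  proof (intro allI impI)
    fix e :: real assume "e > 0"
    have "emeasure M {x \<in> space M. \<bar>c n * indicator (A n) x - 0\<bar> > e} \<le> emeasure M (A n)" for n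
      using A(1) \<open>e > 0\<close> by (intro emeasure_mono) (auto simp: indicator_def split: if_splits)
    then show "(\<lambda>n. emeasure M {x \<in> space M. \<bar>c n * indicator (A n) x - 0\<bar> > e}) \<longlonglongrightarrow> 0"
      by (intro tendsto_sandwich[OF _ _ tendsto_const lim]) auto
  qed
  then have "\<exists>n. ae_class M (\<lambda>x. c n * indicator (A n) x) \<in> U"
    by (rule openin_measure_topology_conv[OF assms(2)]) (use A assms(3) in auto)
  with c show False by blast
qed

lemma locally_compact_imp_bounded_away:
  assumes "locally_compact_space (measure_topology M)"
  shows "bounded_away_from_zero M"
proof (rule ccontr)
  assume neg: "\<not> bounded_away_from_zero M"
  have "ae_class M (\<lambda>x. 0) \<in> topspace (measure_topology M)"
    by (simp add: topspace_measure_topology ae_class_in_meas_classes)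
  then obtain U K where UK: "openin (measure_topology M) U" "compactin (measure_topology M) K"
    "ae_class M (\<lambda>x. 0) \<in> U" "U \<subseteq> K"
    using assms unfolding locally_compact_space_def by blast
  obtain A where A: "A \<in> sets M" "emeasure M A \<noteq> 0"
    "\<And>c. ae_class M (\<lambda>x. c * indicator A x) \<in> U"
    using multiples_in_neighbourhood[OF neg UK(1,3)] by blast
  define V where "V n = ae_class M ` {f \<in> borel_measurable M. not_ess_above M A (real n) f}"
    for n :: nat
  have "openin (measure_topology M) (V n)" for n
    unfolding V_def by (rule openin_not_ess_above[OF A(1)])
  moreover have "K \<subseteq> \<Union> (range V)"
  proof
    fix F assume "F \<in> K"
    then have "F \<in> meas_classes M"
      using UK(2) by (auto simp: compactin_def topspace_measure_topology)
    then show "F \<in> \<Union> (range V)"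
      unfolding V_def using ex_not_ess_above[OF A(2,1)] by (elim meas_classes_memberE) blast
  qed
  ultimately obtain \<F> where "finite \<F>" "\<F> \<subseteq> range V" "K \<subseteq> \<Union>\<F>"
    using UK(2) unfolding compactin_def by (metis (no_types, lifting) imageE)
  then obtain I where I: "finite I" "K \<subseteq> (\<Union>n\<in>I. V n)"
    by (metis finite_subset_image)
  \<comment> \<open>\<open>N\<close> bounds the indices of the finite subcover; the inserted 0
    covers the case of empty \<open>I\<close>.\<close>
  define N where "N = Max (insert 0 I)"
  let ?g = "\<lambda>x. real N * indicator A x"
  have [measurable]: "?g \<in> borel_measurable M" using A(1) by measurable
  obtain n where "n \<in> I" "ae_class M ?g \<in> V n" using A(3) UK(4) I(2) by blast
  then obtain f where f: "f \<in> borel_measurable M" "not_ess_above M A (real n) f"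
    "ae_class M ?g = ae_class M f" by (auto simp: V_def)
  then obtain c where c: "c < real n" "\<not> (AE x in M. x \<in> A \<longrightarrow> \<bar>f x\<bar> > c)"
    by (auto simp: not_ess_above_def)
  have "n \<le> N" using \<open>n \<in> I\<close> I(1) by (simp add: N_def)
  \<comment> \<open>Every representative of the class of \<open>?g\<close> equals \<open>N\<close>
    almost everywhere on \<open>A\<close>, and \<open>N \<ge> n > c\<close>.\<close>
  have "AE x in M. ?g x = f x" using f ae_class_eq_iff[of ?g M f] by simp
  then have "AE x in M. x \<in> A \<longrightarrow> \<bar>f x\<bar> > c"
    by eventually_elim (use c(1) \<open>n \<le> N\<close> in auto)
  with c(2) show False by simp
qed

section \<open>Measures bounded away from zero are finitely atomic\<close>

text \<open>For each rational \<open>q\<close>, almost all of \<open>A\<close> lies on one side of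
  the cut \<open>g x < of_rat q\<close>. As there are countably many \<open>q\<close>, almost all
  points of \<open>A\<close> give the same rational cut and hence the same value of
  \<open>g\<close>.\<close>

lemma AE_const_on_atom:
  assumes [measurable]: "A \<in> sets M"
    and atom: "\<And>B. B \<in> sets M \<Longrightarrow> emeasure M (A \<inter> B) = 0 \<or> emeasure M (A - B) = 0"
    and [measurable]: "g \<in> borel_measurable M"
  shows "\<exists>c::real. AE x in M. x \<in> A \<longrightarrow> g x = c"
proof -
  have "(AE x in M. x \<in> A \<longrightarrow> \<not> g x < of_rat q) \<or> (AE x in M. x \<in> A \<longrightarrow> g x < of_rat q)"
    for q :: rat
  proof -
    let ?B = "{x \<in> space M. g x < of_rat q}"
    have [measurable]: "?B \<in> sets M" by measurable
    have "A \<inter> ?B \<in> null_sets M \<or> A - ?B \<in> null_sets M"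
      using atom[of ?B] by (auto simp: null_sets_def)
    then show ?thesis
    proof
      assume "A \<inter> ?B \<in> null_sets M"
      from AE_not_in[OF this] have "AE x in M. x \<in> A \<longrightarrow> \<not> g x < of_rat q"
        using AE_space by eventually_elim auto
      then show ?thesis ..
    next
      assume "A - ?B \<in> null_sets M"
      from AE_not_in[OF this] have "AE x in M. x \<in> A \<longrightarrow> g x < of_rat q"
        using AE_space by eventually_elim auto
      then show ?thesis ..
    qed
  qed
  \<comment> \<open>The side is selected by a condition independent of \<open>x\<close>, so that the
    statement becomes one almost-everywhere claim per \<open>q\<close> and the countable
    intersection applies.\<close>
  then have "AE x in M. ((AE y in M. y \<in> A \<longrightarrow> \<not> g y < of_rat q) \<longrightarrow> x \<in> A \<longrightarrow> \<not> g x < of_rat q)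
      \<and> (\<not> (AE y in M. y \<in> A \<longrightarrow> \<not> g y < of_rat q) \<longrightarrow> x \<in> A \<longrightarrow> g x < of_rat q)" for q :: rat
    by (cases "AE y in M. y \<in> A \<longrightarrow> \<not> g y < of_rat q") auto
  then have "AE x in M. \<forall>q. ((AE y in M. y \<in> A \<longrightarrow> \<not> g y < of_rat q) \<longrightarrow> x \<in> A \<longrightarrow> \<not> g x < of_rat q)
      \<and> (\<not> (AE y in M. y \<in> A \<longrightarrow> \<not> g y < of_rat q) \<longrightarrow> x \<in> A \<longrightarrow> g x < of_rat q)"
    unfolding AE_all_countable by blast
  then have ae: "AE x in M. \<forall>q::rat. x \<in> A \<longrightarrow>
      (g x < of_rat q \<longleftrightarrow> \<not> (AE y in M. y \<in> A \<longrightarrow> \<not> g y < of_rat q))"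
    by eventually_elim blast
  \<comment> \<open>\<open>G x\<close> says that \<open>g x\<close> realises the common cut; density
    of the rationals makes any two such values equal.\<close>
  define G where "G x \<longleftrightarrow> (\<forall>q::rat. g x < of_rat q \<longleftrightarrow> \<not> (AE y in M. y \<in> A \<longrightarrow> \<not> g y < of_rat q))"
    for x
  have eq: "g x = g y" if "G x" "G y" for x y
    using that of_rat_dense[of "g x" "g y"] of_rat_dense[of "g y" "g x"]
    unfolding G_def by (metis linorder_neqE_linordered_idom less_asym)
  have G: "AE x in M. x \<in> A \<longrightarrow> G x" using ae by eventually_elim (auto simp: G_def)
  show ?thesis
  proof (cases "\<exists>x. G x")
    case True
    then obtain x0 where "G x0" ..
    from G have "AE x in M. x \<in> A \<longrightarrow> g x = g x0"
      by eventually_elim (use eq \<open>G x0\<close> in blast)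
    then show ?thesis ..
  next
    \<comment> \<open>Here almost every point is outside \<open>A\<close>, and 0 is an arbitrary
      choice of constant.\<close>
    case False
    with G have "AE x in M. x \<in> A \<longrightarrow> g x = 0"
      by eventually_elim (use False in blast)
    then show ?thesis ..
  qed
qed

text \<open>The pieces are the fibres of an index map, so that functions constant on pieces take the
  form \<open>v (p x)\<close>.\<close>

definition positive_partition :: "'a measure \<Rightarrow> nat \<Rightarrow> ('a \<Rightarrow> nat) \<Rightarrow> bool" where
  "positive_partition M n p \<longleftrightarrow> p \<in> measurable M (count_space UNIV) \<and> (\<forall>x\<in>space M. p x < n) \<and>
     (\<forall>i<n. emeasure M (p -` {i} \<inter> space M) \<noteq> 0)"

text \<open>The pieces are disjoint, each has probability at least \<open>c\<close>, and the total
  is at most 1.\<close>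

lemma (in prob_space) positive_partition_size:
  assumes "positive_partition M n p" and c: "c > 0"
    "\<And>A. A \<in> sets M \<Longrightarrow> emeasure M A = 0 \<or> emeasure M A \<ge> ennreal c"
  shows "real n * c \<le> 1"
proof -
  have [measurable]: "p \<in> measurable M (count_space UNIV)"
    using assms(1) by (simp add: positive_partition_def)
  have sets: "p -` {i} \<inter> space M \<in> sets M" for i by measurable
  have "c \<le> prob (p -` {i} \<inter> space M)" if "i < n" for i
    using c(2)[OF sets] assms(1) that c(1)
    by (auto simp: positive_partition_def emeasure_eq_measure)
  then have "real n * c \<le> (\<Sum>i<n. prob (p -` {i} \<inter> space M))"
    using sum_bounded_below[of "{..<n}" c "\<lambda>i. prob (p -` {i} \<inter> space M)"] by simp
  also have "\<dots> = prob (\<Union>i<n. p -` {i} \<inter> space M)"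
    by (rule finite_measure_finite_Union[symmetric])
      (auto simp: disjoint_family_on_def sets)
  also have "\<dots> \<le> 1" by simp
  finally show ?thesis .
qed

text \<open>The part of piece \<open>i\<close> inside \<open>B\<close> receives the fresh index
  \<open>n\<close>, while the rest keeps index \<open>i\<close>.\<close>

lemma positive_partition_split:
  assumes "positive_partition M n p" "i < n" and [measurable]: "B \<in> sets M"
    and pos: "emeasure M ((p -` {i} \<inter> space M) \<inter> B) \<noteq> 0"
      "emeasure M ((p -` {i} \<inter> space M) - B) \<noteq> 0"
  shows "\<exists>q. positive_partition M (Suc n) q"
proof -
  have [measurable]: "p \<in> measurable M (count_space UNIV)"
    and p: "\<And>x. x \<in> space M \<Longrightarrow> p x < n"
      "\<And>j. j < n \<Longrightarrow> emeasure M (p -` {j} \<inter> space M) \<noteq> 0"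
    using assms(1) by (auto simp: positive_partition_def)
  define q where "q = (\<lambda>x. if x \<in> (p -` {i} \<inter> space M) \<inter> B then n else p x)"
  have [measurable]: "(p -` {i} \<inter> space M) \<inter> B \<in> sets M" by measurable
  have "q \<in> measurable M (count_space UNIV)" unfolding q_def by measurable
  moreover have "\<forall>x\<in>space M. q x < Suc n" using p(1) by (auto simp: q_def less_Suc_eq)
  moreover have "emeasure M (q -` {j} \<inter> space M) \<noteq> 0" if j: "j < Suc n" for j
  proof -
    consider "j = n" | "j = i" "j < n" | "j \<noteq> i" "j < n" using j less_Suc_eq by blast
    then show ?thesis
    proof cases
      case 1
      then have "q -` {j} \<inter> space M = (p -` {i} \<inter> space M) \<inter> B"
        using p(1)[THEN less_imp_neq] by (auto simp: q_def split: if_splits)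
      then show ?thesis using pos by simp
    next
      case 2
      then have "q -` {j} \<inter> space M = (p -` {i} \<inter> space M) - B"
        by (auto simp: q_def split: if_splits)
      then show ?thesis using pos by simp
    next
      case 3
      then have "q -` {j} \<inter> space M = p -` {j} \<inter> space M"
        by (auto simp: q_def split: if_splits)
      then show ?thesis using p(2) 3 by simp
    qed
  qed
  ultimately show ?thesis unfolding positive_partition_def by blast
qed

lemma (in prob_space) finite_atomic_partition:
  assumes "bounded_away_from_zero M"
  obtains n :: nat and p where "p \<in> measurable M (count_space UNIV)"
    "\<And>x. x \<in> space M \<Longrightarrow> p x < n"
    "\<And>g. g \<in> borel_measurable M \<Longrightarrow> \<exists>v::nat \<Rightarrow> real. AE x in M. g x = v (p x)"
proof -
  obtain c where c: "c > 0"
    "\<And>A. A \<in> sets M \<Longrightarrow> emeasure M A = 0 \<or> emeasure M A \<ge> ennreal c"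
    using assms unfolding bounded_away_from_zero_def by blast
  obtain b :: nat where b: "1 / c < real b" using reals_Archimedean2 by blast
  have bound: "n \<le> b" if "\<exists>p. positive_partition M n p" for n
  proof -
    have "real n * c \<le> 1" using that positive_partition_size c by blast
    then have "real n \<le> 1 / c" using c(1) by (simp add: field_simps)
    with b show ?thesis by simp
  qed
  \<comment> \<open>The one-piece partition starts the search for a largest \<open>n\<close>, which
    exists because all sizes are bounded by \<open>b\<close>.\<close>
  have "positive_partition M 1 (\<lambda>x. 0)"
    by (auto simp: positive_partition_def emeasure_space_1)
  then have "\<exists>n. \<exists>p. positive_partition M n p" by blast
  with bound obtain n where n: "\<exists>p. positive_partition M n p"
    "\<And>m. \<exists>p. positive_partition M m p \<Longrightarrow> m \<le> n"
    using Nat.ex_has_greatest_nat[of "\<lambda>n. \<exists>p. positive_partition M n p" _ b] by meson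
  then obtain p where p: "positive_partition M n p" by blast
  then have p_meas [measurable]: "p \<in> measurable M (count_space UNIV)"
    and p_less: "\<And>x. x \<in> space M \<Longrightarrow> p x < n"
    by (auto simp: positive_partition_def)
  have "\<exists>v::nat \<Rightarrow> real. AE x in M. g x = v (p x)" if [measurable]: "g \<in> borel_measurable M" for g
  proof -
    \<comment> \<open>By maximality of \<open>n\<close>, no \<open>B\<close> cuts fibre
      \<open>i\<close> into two parts of positive measure, so the fibre satisfies the atom
      condition.\<close>
    have "\<exists>c. AE x in M. x \<in> p -` {i} \<inter> space M \<longrightarrow> g x = c" if "i < n" for i
    proof (rule AE_const_on_atom)
      fix B assume "B \<in> sets M"
      then show "emeasure M (p -` {i} \<inter> space M \<inter> B) = 0 \<or>
          emeasure M (p -` {i} \<inter> space M - B) = 0"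
        using positive_partition_split[OF p that] n(2)[of "Suc n"] by force
    qed measurable
    then obtain v where "\<And>i. i < n \<Longrightarrow> AE x in M. x \<in> p -` {i} \<inter> space M \<longrightarrow> g x = v i"
      by metis
    then have "AE x in M. \<forall>i\<in>{..<n}. x \<in> p -` {i} \<inter> space M \<longrightarrow> g x = v i"
      by (intro AE_finite_allI) auto
    then have "AE x in M. g x = v (p x)" using AE_space
      by eventually_elim (use p_less in auto)
    then show ?thesis by blast
  qed
  with p_meas p_less show thesis by (rule that)
qed

section \<open>Compact neighbourhoods\<close>

text \<open>Only the finitely many coordinates below \<open>n\<close> are seen through
  \<open>p\<close>, so coordinatewise convergence is uniform there and the deviation set is
  eventually empty.\<close>

lemma conv_in_measure_pointwise_partition:
  fixes vs :: "nat \<Rightarrow> nat \<Rightarrow> real"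
  assumes "\<And>x. x \<in> space M \<Longrightarrow> p x < (n::nat)" and "\<And>i. (\<lambda>k. vs k i) \<longlonglongrightarrow> v i"
  shows "conv_in_measure M (\<lambda>k x. vs k (p x)) (\<lambda>x. v (p x))"
  unfolding conv_in_measure_def
proof (intro allI impI)
  fix c :: real assume "c > 0"
  then have "\<forall>\<^sub>F k in sequentially. \<forall>i\<in>{..<n}. \<bar>vs k i - v i\<bar> < c"
    using assms(2) by (intro eventually_ball_finite) (auto simp: tendsto_iff dist_real_def)
  then have "\<forall>\<^sub>F k in sequentially. emeasure M {x \<in> space M. \<bar>vs k (p x) - v (p x)\<bar> > c} = 0"
  proof eventually_elim
    case (elim k)
    have "\<not> \<bar>vs k (p x) - v (p x)\<bar> > c" if "x \<in> space M" for x
      using bspec[OF elim, of "p x"] assms(1)[OF that] by simp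
    then have "{x \<in> space M. \<bar>vs k (p x) - v (p x)\<bar> > c} = {}" by blast
    then show ?case by (simp only: emeasure_empty)
  qed
  then show "(\<lambda>k. emeasure M {x \<in> space M. \<bar>vs k (p x) - v (p x)\<bar> > c}) \<longlonglongrightarrow> 0"
    by (rule tendsto_eventually)
qed

text \<open>Closedness of the preimage of a closed set can be tested on sequences in
  \<open>nat \<Rightarrow> real\<close>, where convergence implies coordinatewise convergence and
  hence convergence in measure of the composites.\<close>

lemma continuous_map_partition_class:
  assumes [measurable]: "p \<in> measurable M (count_space UNIV)"
    and "\<And>x. x \<in> space M \<Longrightarrow> p x < (n::nat)"
  shows "continuous_map euclidean (measure_topology M) (\<lambda>v::nat \<Rightarrow> real. ae_class M (\<lambda>x. v (p x)))"
  unfolding continuous_map_def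
proof (intro conjI allI impI)
  have meas [measurable]: "(\<lambda>x. v (p x)) \<in> borel_measurable M" for v :: "nat \<Rightarrow> real" by measurable
  show "(\<lambda>v. ae_class M (\<lambda>x. v (p x))) \<in> topspace euclidean \<rightarrow> topspace (measure_topology M)"
    by (simp add: topspace_measure_topology ae_class_in_meas_classes)
  fix U assume U: "openin (measure_topology M) U"
  let ?C = "{v::nat \<Rightarrow> real. ae_class M (\<lambda>x. v (p x)) \<notin> U}"
  have "closed ?C"
    unfolding closed_sequential_limits
  proof (intro allI impI, elim conjE)
    fix vs and v :: "nat \<Rightarrow> real"
    assume vs: "\<forall>k. vs k \<in> ?C" and "vs \<longlonglongrightarrow> v"
    then have "(\<lambda>k. vs k i) \<longlonglongrightarrow> v i" for i
      by (auto intro: continuous_on_tendsto_compose[OF continuous_on_product_coordinates])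
    with assms(2) have "conv_in_measure M (\<lambda>k x. vs k (p x)) (\<lambda>x. v (p x))"
      by (rule conv_in_measure_pointwise_partition)
    from openin_measure_topology_conv[OF U this] vs show "v \<in> ?C" by auto
  qed
  then have "open (- ?C)" by (simp add: open_Compl)
  moreover have "- ?C = {v \<in> topspace euclidean. ae_class M (\<lambda>x. v (p x)) \<in> U}" by auto
  ultimately show "openin euclidean {v \<in> topspace euclidean. ae_class M (\<lambda>x. v (p x)) \<in> U}"
    by simp
qed

text \<open>A deviation set of measure below the lower bound \<open>d\<close> is null, so
  convergence in measure gives essentially uniform closeness; half of the gap \<open>r - c\<close>
  absorbs the error.\<close>

lemma openin_ess_ball:
  assumes "bounded_away_from_zero M" and [measurable]: "f \<in> borel_measurable M"
  shows "openin (measure_topology M)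
    (ae_class M ` {g \<in> borel_measurable M. \<exists>c<r. AE x in M. \<bar>g x - f x\<bar> \<le> c})"
proof (rule openin_measure_topology_ae_classI)
  fix gs g
  assume [measurable]: "\<And>n. gs n \<in> borel_measurable M" "g \<in> borel_measurable M"
    and conv: "conv_in_measure M gs g" and "\<exists>c<r. AE x in M. \<bar>g x - f x\<bar> \<le> c"
  then obtain c where c: "c < r" "AE x in M. \<bar>g x - f x\<bar> \<le> c" by blast
  obtain d where d: "d > 0" "\<And>A. A \<in> sets M \<Longrightarrow> emeasure M A = 0 \<or> emeasure M A \<ge> ennreal d"
    using assms(1) unfolding bounded_away_from_zero_def by blast
  obtain n where n: "emeasure M {x \<in> space M. \<bar>gs n x - g x\<bar> > (r - c) / 2} < ennreal d"
    using conv_in_measure_eventually_less[OF conv, of "(r - c) / 2" "ennreal d"] c(1) d(1) by auto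
  have "{x \<in> space M. \<bar>gs n x - g x\<bar> > (r - c) / 2} \<in> sets M" by measurable
  with d(2) n have "{x \<in> space M. \<bar>gs n x - g x\<bar> > (r - c) / 2} \<in> null_sets M"
    by (metis (lifting) not_less null_setsI)
  from AE_not_in[OF this] have "AE x in M. \<bar>gs n x - g x\<bar> \<le> (r - c) / 2"
    using AE_space by eventually_elim auto
  with c(2) have "AE x in M. \<bar>gs n x - f x\<bar> \<le> (r + c) / 2"
    by eventually_elim (auto simp: field_simps abs_if split: if_splits)
  moreover have "(r + c) / 2 < r" using c(1) by simp
  ultimately show "\<exists>n. \<exists>c<r. AE x in M. \<bar>gs n x - f x\<bar> \<le> c" by blast
qed

text \<open>Tychonoff's theorem for the abstract product topology, transferred to the type class
  topology on functions.\<close>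

lemma compact_interval_box: "compact {v::nat \<Rightarrow> real. \<forall>i. v i \<in> {a i..b i}}"
proof -
  have "compactin (product_topology (\<lambda>i::nat. euclideanreal) UNIV) (PiE UNIV (\<lambda>i. {a i..b i}))"
    by (simp add: compactin_PiE)
  moreover have "PiE UNIV (\<lambda>i. {a i..b i}) = {v. \<forall>i. v i \<in> {a i..b i}}"
    by (auto simp: PiE_def)
  ultimately show ?thesis by (simp add: euclidean_product_topology)
qed

lemma (in prob_space) bounded_away_imp_locally_compact:
  assumes bd: "bounded_away_from_zero M"
  shows "locally_compact_space (measure_topology M)"
  unfolding locally_compact_space_def
proof
  fix F assume "F \<in> topspace (measure_topology M)"
  then obtain f where [measurable]: "f \<in> borel_measurable M" and F: "F = ae_class M f"
    by (auto simp: topspace_measure_topology elim: meas_classes_memberE)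
  obtain n :: nat and p where [measurable]: "p \<in> measurable M (count_space UNIV)"
    and less: "\<And>x. x \<in> space M \<Longrightarrow> p x < n"
    and rep: "\<And>g. g \<in> borel_measurable M \<Longrightarrow> \<exists>v::nat \<Rightarrow> real. AE x in M. g x = v (p x)"
    by (rule finite_atomic_partition[OF bd]) blast
  obtain a where a: "AE x in M. f x = a (p x)" using rep[of f] by auto
  define \<Phi> where "\<Phi> = (\<lambda>v::nat \<Rightarrow> real. ae_class M (\<lambda>x. v (p x)))"
  define U where "U = ae_class M ` {g \<in> borel_measurable M. \<exists>c<1. AE x in M. \<bar>g x - f x\<bar> \<le> c}"
  define K where "K = \<Phi> ` {v. \<forall>i. v i \<in> {a i - 1..a i + 1}}"
  have "openin (measure_topology M) U" unfolding U_def by (rule openin_ess_ball[OF bd]) measurable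
  moreover have "continuous_map euclidean (measure_topology M) \<Phi>"
    unfolding \<Phi>_def by (rule continuous_map_partition_class[OF _ less]) auto
  then have "compactin (measure_topology M) K"
    unfolding K_def by (intro image_compactin) (auto intro: compact_interval_box[simplified])
  moreover have "F \<in> U" unfolding U_def F by (auto intro!: imageI exI[of _ 0])
  moreover have "U \<subseteq> K"
  proof
    fix G assume "G \<in> U"
    then obtain g c where [measurable]: "g \<in> borel_measurable M" and G: "G = ae_class M g"
      and c: "c < 1" "AE x in M. \<bar>g x - f x\<bar> \<le> c" by (auto simp: U_def)
    obtain w where w: "AE x in M. g x = w (p x)" using rep[of g] by auto
    \<comment> \<open>\<open>w\<close> is arbitrary at indices outside the range of \<open>p\<close>, so it is clamped into the box.\<close>
    define v where "v i = max (a i - 1) (min (a i + 1) (w i))" for i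
    \<comment> \<open>Almost everywhere \<bar>w (p x) - a (p x)\<bar> \<le> c < 1, so clamping
      leaves \<open>w (p x)\<close> unchanged there.\<close>
    have "AE x in M. g x = v (p x)"
      using a c(2) w by eventually_elim (use c(1) in \<open>auto simp: v_def\<close>)
    then have "G = \<Phi> v" unfolding G \<Phi>_def by (subst ae_class_eq_iff) auto
    moreover have "\<forall>i. v i \<in> {a i - 1..a i + 1}" by (auto simp: v_def)
    ultimately show "G \<in> K" unfolding K_def by blast
  qed
  ultimately show "\<exists>U K. openin (measure_topology M) U \<and> compactin (measure_topology M) K \<and>
      F \<in> U \<and> U \<subseteq> K" by blast
qed

theorem corollary3p5:
  fixes M :: "'a measure"
  assumes "prob_space M"
  shows "locally_compact_space (measure_topology M) \<longleftrightarrow> bounded_away_from_zero M"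
  using locally_compact_imp_bounded_away prob_space.bounded_away_imp_locally_compact[OF assms]
  by blast

end
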